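(* Let $X,Y$ be complex Banach spaces, let $A,E\in B(X,Y)$ and $\bar A=A+E$, and let $T\subset X$, $S\subset Y$ be closed subspaces such that $A_{T,S}^{(2)}$ exists. Put $\kappa=\|A\|\,\|A_{T,S}^{(2)}\|$. Let $T'\subset X$, $S'\subset Y$ be closed subspaces with $\hat\delta(T,T')<\dfrac{1}{(1+\kappa)^2}$ and $\hat\delta(S,S')<\dfrac{1}{3+\kappa}$. Suppose that $\|A_{T,S}^{(2)}\|\,\|E\|<\dfrac{2\kappa}{(1+\kappa)(4+\kappa)}$. Then $\bar A_{T',S'}^{(2)}$ exists and: (1) For arbitrary operators $G,\tilde G,\tilde H\in B(Y,X)$ with $R(G)=T$, $R(\tilde G)=R(\tilde H)=T'$, $N(G)=N(\tilde G)=S$, $N(\tilde H)=S'$, setting $F=\tilde G-G$ and $\tilde F=\tilde H-\tilde G$, $$\begin{aligned} \bar A_{T',S'}^{(2)}=\;&\Big[I+A_{T,S}^{(2)}E+(I-A_{T,S}^{(2)}A)F(I+(AG)^gAF)^{-1}(AG)^gE\\ &+\{A_{T,S}^{(2)}+(I-A_{T,S}^{(2)}A)F(I+(AG)^gAF)^{-1}(AG)^g\}\\ &\quad\times(I+(A\tilde G)^gA\tilde F)^{-1}(A\tilde G)^gA\tilde F(I-AA_{T,S}^{(2)})(I+AF(AG)^g)^{-1}E\Big]^{-1}\\ &\times\Big[A_{T,S}^{(2)}+(I-A_{T,S}^{(2)}A)F(I+(AG)^gAF)^{-1}(AG)^g\\ &+\{A_{T,S}^{(2)}+(I-A_{T,S}^{(2)}A)F(I+(AG)^gAF)^{-1}(AG)^g\}\\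 &\quad\times(I+(A\tilde G)^gA\tilde F)^{-1}(A\tilde G)^gA\tilde F(I-AA_{T,S}^{(2)})(I+AF(AG)^g)^{-1}\Big]. \end{aligned}$$ (2) $$\|\bar A_{T',S'}^{(2)}\|\le\frac{(1+\hat\delta(S',S))\,\|A_{T,S}^{(2)}\|}{1-(1+\kappa)\hat\delta(T,T')-\kappa\,\hat\delta(S',S)-(1+\hat\delta(S',S))\|A_{T,S}^{(2)}\|\,\|E\|}.$$ (3) $$\frac{\|\bar A_{T',S'}^{(2)}-A_{T,S}^{(2)}\|}{\|A_{T,S}^{(2)}\|}\le\frac{(1+\kappa)\big(\hat\delta(T,T')+\hat\delta(S',S)\big)+(1+\hat\delta(S',S))\|A_{T,S}^{(2)}\|\,\|E\|}{1-(1+\kappa)\hat\delta(T,T')-\kappa\,\hat\delta(S',S)-(1+\hat\delta(S',S))\|A_{T,S}^{(2)}\|\,\|E\|}.$$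
   Context: $B(X,Y)$ is the set of bounded linear operators from $X$ to $Y$; $R(\cdot)$ and $N(\cdot)$ denote range and kernel; $I$ is the identity operator on the appropriate space. For $A\in B(X,Y)$ and closed subspaces $T\subset X$, $S\subset Y$, $A_{T,S}^{(2)}$ denotes the unique operator $G\in B(Y,X)$ satisfying $GAG=G$, $R(G)=T$, $N(G)=S$; it is said to exist if there is such an operator. It is known that it exists if and only if $N(A)\cap T=\{0\}$ and $Y=AT\dotplus S$ (topological direct sum). For closed subspaces $M,N$ of a complex Banach space $Z$: $\delta(M,N)=\sup\{\mathrm{dist}(x,N): x\in M,\ \|x\|=1\}$ if $M\ne\{0\}$ and $\delta(\{0\},N)=0$, where $\mathrm{dist}(x,N)=\inf\{\|x-y\|: y\in N\}$. The gap is $\hat\delta(M,N)=\max\{\delta(M,N),\delta(N,M)\}$. An operator $C\in B(Z,Z)$ is group invertible if there is $B\in B(Z,Z)$ with $CBC=C$, $BCB=B$, $CB=BC$; this $B$ (unique) is the group inverse, denoted $C^g$. It is known that if $A_{T,S}^{(2)}$ exists and $G\in B(Y,X)$ has $R(G)=T$, $N(G)=S$, then $AG$ is group invertible. The existence of all the inverses and group inverses appearing in the formula is part of the assertion. *)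

theory Defs
  imports "HOL-Analysis.Analysis"
begin

text \<open>
  HOL-Analysis only knows real Banach spaces. A complex Banach space is rendered as a real one
  (\<open>banach\<close>) with a complex scalar multiplication that extends the real one and for which the norm
  is homogeneous.
\<close>

class complex_banach = banach +
  fixes scaleC :: "complex \<Rightarrow> 'a \<Rightarrow> 'a" (infixr "*\<^sub>C" 75)
  assumes scaleC_add_right: "a *\<^sub>C (x + y) = a *\<^sub>C x + a *\<^sub>C y"
    and scaleC_add_left: "(a + b) *\<^sub>C x = a *\<^sub>C x + b *\<^sub>C x"
    and scaleC_scaleC: "a *\<^sub>C (b *\<^sub>C x) = (a * b) *\<^sub>C x"
    and scaleC_of_real: "complex_of_real r *\<^sub>C x = r *\<^sub>R x"
    and norm_scaleC: "norm (a *\<^sub>C x) = cmod a * norm x"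

lemma vector_space_scaleC:
  "vector_space (scaleC :: complex \<Rightarrow> 'a \<Rightarrow> 'a::complex_banach)"
proof
  show "1 *\<^sub>C x = x" for x :: 'a
    using scaleC_of_real[of 1 x] by simp
qed (simp_all add: scaleC_add_right scaleC_add_left scaleC_scaleC)

instantiation complex :: complex_banach
begin

definition scaleC_complex :: "complex \<Rightarrow> complex \<Rightarrow> complex"
  where "scaleC_complex a x = a * x"

instance
  by standard (simp_all add: scaleC_complex_def algebra_simps scaleR_conv_of_real norm_mult)

end

definition closed_csubspace :: "'a::complex_banach set \<Rightarrow> bool"
  where "closed_csubspace M \<longleftrightarrow> module.subspace scaleC M \<and> closed M"

text \<open>
  \<open>'a \<Rightarrow>\<^sub>L 'b\<close> is the type of bounded real-linear maps. The complex space \<open>B(X,Y)\<close> consists of those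
  that are complex-linear; the operator norm is the same.
\<close>

definition clinear_op :: "('a::complex_banach \<Rightarrow>\<^sub>L 'b::complex_banach) \<Rightarrow> bool"
  where "clinear_op A \<longleftrightarrow> Vector_Spaces.linear scaleC scaleC (blinfun_apply A)"

text \<open>Unlike \<open>o\<^sub>L\<close>, which has priority 55, this product binds more tightly than \<open>+\<close>.\<close>

notation blinfun_compose (infixl "\<cdot>" 70)

definition op_range :: "('a::complex_banach \<Rightarrow>\<^sub>L 'b::complex_banach) \<Rightarrow> 'b set"
  where "op_range A = range (blinfun_apply A)"

definition op_kernel :: "('a::complex_banach \<Rightarrow>\<^sub>L 'b::complex_banach) \<Rightarrow> 'a set"
  where "op_kernel A = {x. blinfun_apply A x = 0}"

definition is_op_inverse ::
  "('a::complex_banach \<Rightarrow>\<^sub>L 'a) \<Rightarrow> ('a \<Rightarrow>\<^sub>L 'a) \<Rightarrow> bool"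
  where "is_op_inverse C D \<longleftrightarrow> clinear_op D \<and> C \<cdot> D = id_blinfun \<and> D \<cdot> C = id_blinfun"

definition op_invertible :: "('a::complex_banach \<Rightarrow>\<^sub>L 'a) \<Rightarrow> bool"
  where "op_invertible C \<longleftrightarrow> (\<exists>D. is_op_inverse C D)"

definition op_inverse :: "('a::complex_banach \<Rightarrow>\<^sub>L 'a) \<Rightarrow> ('a \<Rightarrow>\<^sub>L 'a)"
  where "op_inverse C = (THE D. is_op_inverse C D)"

definition is_group_inverse ::
  "('a::complex_banach \<Rightarrow>\<^sub>L 'a) \<Rightarrow> ('a \<Rightarrow>\<^sub>L 'a) \<Rightarrow> bool"
  where "is_group_inverse C B \<longleftrightarrow>
    clinear_op B \<and> C \<cdot> B \<cdot> C = C \<and> B \<cdot> C \<cdot> B = B \<and> C \<cdot> B = B \<cdot> C"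

definition group_invertible :: "('a::complex_banach \<Rightarrow>\<^sub>L 'a) \<Rightarrow> bool"
  where "group_invertible C \<longleftrightarrow> (\<exists>B. is_group_inverse C B)"

definition group_inverse :: "('a::complex_banach \<Rightarrow>\<^sub>L 'a) \<Rightarrow> ('a \<Rightarrow>\<^sub>L 'a)"
  where "group_inverse C = (THE B. is_group_inverse C B)"

text \<open>The outer inverse \<open>A\<^bsub>T,S\<^esub>\<^bsup>(2)\<^esup>\<close> with range \<open>T\<close> and kernel \<open>S\<close>.\<close>

definition is_outer_inverse ::
  "('a::complex_banach \<Rightarrow>\<^sub>L 'b::complex_banach) \<Rightarrow> 'a set \<Rightarrow> 'b set \<Rightarrow> ('b \<Rightarrow>\<^sub>L 'a) \<Rightarrow> bool"
  where "is_outer_inverse A T S G \<longleftrightarrow>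
    clinear_op G \<and> G \<cdot> A \<cdot> G = G \<and> op_range G = T \<and> op_kernel G = S"

definition outer_inverse_exists ::
  "('a::complex_banach \<Rightarrow>\<^sub>L 'b::complex_banach) \<Rightarrow> 'a set \<Rightarrow> 'b set \<Rightarrow> bool"
  where "outer_inverse_exists A T S \<longleftrightarrow> (\<exists>G. is_outer_inverse A T S G)"

definition outer_inverse ::
  "('a::complex_banach \<Rightarrow>\<^sub>L 'b::complex_banach) \<Rightarrow> 'a set \<Rightarrow> 'b set \<Rightarrow> ('b \<Rightarrow>\<^sub>L 'a)"
  where "outer_inverse A T S = (THE G. is_outer_inverse A T S G)"

text \<open>The three descriptions above determine at most one operator.\<close>

lemma blinfun_compose_assoc: "(A \<cdot> B) \<cdot> C = A \<cdot> (B \<cdot> C)"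
  by (rule blinfun_eqI) simp

lemma is_op_inverse_unique:
  assumes "is_op_inverse C D" "is_op_inverse C D'"
  shows "D = D'"
proof (rule blinfun_eqI)
  fix x
  have "D (C z) = z" "C (D' z) = z" for z
    using assms unfolding is_op_inverse_def
    by (metis blinfun_apply_blinfun_compose blinfun_apply_id_blinfun id_apply)+
  then show "D x = D' x" by metis
qed

lemma is_group_inverse_unique:
  assumes "is_group_inverse C B" "is_group_inverse C B'"
  shows "B = B'"
proof -
  have h: "C \<cdot> B \<cdot> C = C" "B \<cdot> C \<cdot> B = B" "C \<cdot> B = B \<cdot> C"
      "C \<cdot> B' \<cdot> C = C" "B' \<cdot> C \<cdot> B' = B'" "C \<cdot> B' = B' \<cdot> C"
    using assms unfolding is_group_inverse_def by blast+
  have "B \<cdot> C = (B \<cdot> C) \<cdot> (B' \<cdot> C)"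
    by (metis h(4) blinfun_compose_assoc)
  also have "\<dots> = (C \<cdot> B \<cdot> C) \<cdot> B'"
    by (metis h(3,6) blinfun_compose_assoc)
  also have "\<dots> = B' \<cdot> C"
    by (simp only: h(1) h(6))
  finally have eq: "B \<cdot> C = B' \<cdot> C" .
  have "B = B' \<cdot> (C \<cdot> B)"
    by (metis h(2) eq blinfun_compose_assoc)
  also have "\<dots> = B' \<cdot> (C \<cdot> B')"
    by (simp only: h(3,6) eq)
  also have "\<dots> = B'"
    by (metis h(5) blinfun_compose_assoc)
  finally show ?thesis .
qed

lemma is_outer_inverse_unique:
  assumes "is_outer_inverse A T S G" "is_outer_inverse A T S G'"
  shows "G = G'"
proof (rule blinfun_eqI)
  fix y
  have GAG: "G (A (G z)) = G z" "G' (A (G' z)) = G' z" for z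
    using assms unfolding is_outer_inverse_def by (metis blinfun_apply_blinfun_compose)+
  have "G y \<in> op_range G'"
    using assms unfolding is_outer_inverse_def op_range_def by blast
  then have "G' (A (G y)) = G y"
    using GAG unfolding op_range_def by force
  moreover have "y - A (G y) \<in> op_kernel G"
    by (simp add: op_kernel_def blinfun.diff_right GAG)
  then have "y - A (G y) \<in> op_kernel G'"
    using assms unfolding is_outer_inverse_def by simp
  then have "G' y = G' (A (G y))"
    by (simp add: op_kernel_def blinfun.diff_right)
  ultimately show "G y = G' y" by simp
qed

text \<open>
  For a subspace \<open>N\<close> one has \<open>infdist x N \<le> norm x\<close>, and a subspace \<open>M \<noteq> {0}\<close> contains unit vectors,
  so the supremum below is a genuine one. On other sets the value is not meaningful.
\<close>

definition gap_delta :: "'a::complex_banach set \<Rightarrow> 'a set \<Rightarrow> real"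
  where "gap_delta M N =
    (if M = {0} then 0 else (SUP x\<in>{x\<in>M. norm x = 1}. infdist x N))"

definition gap :: "'a::complex_banach set \<Rightarrow> 'a set \<Rightarrow> real"
  where "gap M N = max (gap_delta M N) (gap_delta N M)"

end

theory Submission
  imports Defs
begin

text \<open>
  An outer inverse of \<open>A\<close> with range \<open>T\<close> and kernel \<open>S\<close> is the same as a decomposition of the
  codomain into \<open>A T\<close> and \<open>S\<close> in which the component \<open>t\<close> of \<open>A t + s\<close> depends boundedly on the
  sum. The proof has an analytic part, which shows that the decomposition survives the perturbation
  and measures the change, and an algebraic part, which expresses the new inverse by the old one.

  Analysis. For \<open>t\<close> in \<open>T'\<close>, \<open>s\<close> in \<open>S'\<close> and \<open>y = (A + E) t + s\<close>, the difference \<open>t - B y\<close> is a sum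
  of three terms: one is small because \<open>T'\<close> is close to \<open>T\<close>, one because \<open>E\<close> is small, one because
  \<open>S'\<close> is close to \<open>S\<close> (\<open>outer_inverse_perturbation_estimate\<close>). If \<open>C\<close> is the new outer inverse,
  then \<open>t = C y\<close>, and the two norm inequalities are rearrangements of this single estimate. The
  estimate also bounds \<open>t\<close> by \<open>y\<close> before \<open>C\<close> is known to exist, so \<open>(A + E) T'\<close> and \<open>S'\<close> form a
  closed direct sum \<open>Z\<close>. That \<open>Z\<close> is the whole space follows once every \<open>y\<close> has distance at most
  \<open>q * norm y\<close> from \<open>Z\<close> with a fixed \<open>q < 1\<close>. Checking this in one step from \<open>B\<close> leads to
  \<open>q = \<kappa> * \<tau> + (1 + \<tau>) * norm B * norm E + (1 + \<kappa>) * \<sigma>\<close>, where \<open>\<tau>\<close> and \<open>\<sigma>\<close> are the gaps; the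
  hypotheses do not keep this below one. Therefore the subspaces are moved first, with \<open>E = 0\<close>
  (\<open>outer_inverse_exists_near\<close>), which gives an outer inverse \<open>B\<^sub>2\<close> of \<open>A\<close> with range \<open>T'\<close> and
  kernel \<open>S'\<close>. Then \<open>E\<close> is added (\<open>outer_inverse_exists_of_perturbation\<close>), where
  \<open>q = norm E * norm B\<^sub>2\<close> is below one because the denominator of the norm bounds is positive.

  Algebra. The range is moved first, then the kernel, then \<open>E\<close> is added. In each step the operator
  to be inverted has an explicit inverse built from outer and group inverses (\<open>change_of_range\<close>,
  \<open>change_of_kernel\<close>, \<open>outer_inverse_of_sum\<close>), and every identity reduces to two facts:
  operators with range \<open>T\<close> absorb \<open>B \<cdot> A\<close> from the left, and operators with kernel \<open>S\<close> absorb
  \<open>A \<cdot> B\<close> from the right. Boundedness of the group inverses is the one place where the bounded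
  inverse theorem enters (\<open>group_inverse_of_product\<close>).
\<close>

section \<open>The bounded inverse theorem\<close>

text \<open>
  Successive approximation: halving the residual again and again produces a geometrically
  convergent series whose sum is an exact preimage.
\<close>

lemma exact_preimage_of_approximate_preimages:
  fixes f :: "'a::banach \<Rightarrow> 'b::real_normed_vector"
  assumes f: "bounded_linear f"
    and approx: "\<And>y. \<exists>x. norm x \<le> C * norm y \<and> norm (y - f x) \<le> norm y / 2"
    and C: "0 \<le> C"
  shows "\<exists>x. f x = y \<and> norm x \<le> 2 * C * norm y"
proof -
  interpret f: bounded_linear f by (fact f)
  obtain h where h: "\<And>y. norm (h y) \<le> C * norm y" "\<And>y. norm (y - f (h y)) \<le> norm y / 2"
    using approx by metis
  define r where "r n = ((\<lambda>z. z - f (h z)) ^^ n) y" for n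
  have r_Suc: "r (Suc n) = r n - f (h (r n))" and r_0: "r 0 = y" for n
    by (simp_all add: r_def)
  have r_le: "norm (r n) \<le> norm y * (1/2) ^ n" for n
  proof (induction n)
    case (Suc n)
    have "norm (r (Suc n)) \<le> norm (r n) / 2"
      unfolding r_Suc by (rule h)
    with Suc show ?case by simp
  qed (simp add: r_0)
  define x where "x n = h (r n)" for n
  have x_le: "norm (x n) \<le> C * norm y * (1/2) ^ n" for n
    using h(1)[of "r n"] mult_left_mono[OF r_le[of n] C] by (simp add: x_def mult.assoc)
  have geo: "(\<lambda>n. C * norm y * (1/2) ^ n) sums (2 * C * norm y)"
    using sums_mult[OF geometric_sums[of "1/2 :: real"], of "C * norm y"] by (simp add: mult_ac)
  have sum_norm: "summable (\<lambda>n. norm (x n))"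
    by (rule summable_comparison_test'[OF sums_summable[OF geo]]) (simp add: x_le)
  then have sum_x: "summable x"
    by (rule summable_norm_cancel)
  have "norm (suminf x) \<le> (\<Sum>n. norm (x n))"
    by (rule summable_norm[OF sum_norm])
  also have "\<dots> \<le> 2 * C * norm y"
    using suminf_le[OF x_le sum_norm sums_summable[OF geo]] sums_unique[OF geo] by simp
  finally have bound: "norm (suminf x) \<le> 2 * C * norm y" .
  have partial: "(\<Sum>n<k. f (x n)) = y - r k" for k
    by (induction k) (simp_all add: r_0 r_Suc x_def)
  have "r \<longlonglongrightarrow> 0"
    by (rule Lim_null_comparison[OF always_eventually[OF allI[OF r_le]]])
      (auto intro!: tendsto_eq_intros LIMSEQ_power_zero)
  then have "(\<lambda>n. f (x n)) sums y"
    unfolding sums_def partial by (auto intro!: tendsto_eq_intros)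
  moreover have "(\<lambda>n. f (x n)) sums f (suminf x)"
    by (rule f.sums[OF summable_sums[OF sum_x]])
  ultimately have "f (suminf x) = y" by (rule sums_unique2[symmetric])
  with bound show ?thesis by blast
qed

text \<open>
  The quantitative form of the open mapping theorem. By Baire, the closure of the image of some
  ball contains a ball; translating its centre to the origin costs a factor two in the norm, and
  scaling then provides the approximate preimages from which exact ones are built.
\<close>

lemma open_mapping_estimate:
  fixes f :: "'a::banach \<Rightarrow> 'b::banach"
  assumes f: "bounded_linear f" and surj: "surj f"
  shows "\<exists>C\<ge>0. \<forall>y. \<exists>x. f x = y \<and> norm x \<le> C * norm y"
proof -
  interpret f: bounded_linear f by (fact f)
  define V where "V n = closure (f ` cball 0 (real n))" for n
  have cover: "\<Union>(range V) = UNIV"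
  proof -
    have "y \<in> \<Union>(range V)" for y
    proof -
      obtain x where x: "f x = y" using surj by (metis surjD)
      obtain n where "norm x \<le> real n" using real_arch_simple by blast
      then have "y \<in> V n"
        using x closure_subset[of "f ` cball 0 (real n)"] by (auto simp: V_def)
      then show ?thesis by blast
    qed
    then show ?thesis by blast
  qed
  have "\<exists>n. interior (V n) \<noteq> {}"
  proof (rule ccontr)
    assume "\<not> ?thesis"
    then have "Met_TC.mtopology interior_of \<Union>(range V) = ({} :: 'b set)"
      by (intro Met_TC.metric_Baire_category_alt)
        (auto simp: complete_UNIV V_def)
    then show False
      unfolding cover by simp
  qed
  then obtain n y0 r where r: "r > 0" and ball: "cball y0 r \<subseteq> V n"
    by (metis equals0I mem_interior_cball)
  have near: "\<exists>x. norm x \<le> 2 * real n \<and> norm (z - f x) \<le> e" if z: "norm z \<le> r" and e: "e > 0" for z e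
  proof -
    have "y0 \<in> V n" "y0 + z \<in> V n"
      using ball r z by (auto simp: subset_iff dist_norm)
    then obtain a b where a: "norm a \<le> real n" "dist (f a) y0 < e/2"
      and b: "norm b \<le> real n" "dist (f b) (y0 + z) < e/2"
      unfolding V_def closure_approachable using e by (auto dest!: spec[of _ "e/2"])
    \<comment> \<open>\<open>z\<close> is the difference of two points of the ball, so differences of preimages serve it.\<close>
    have "z - f (b - a) = (f a - y0) - (f b - (y0 + z))"
      by (simp add: f.diff)
    then have "norm (z - f (b - a)) \<le> norm (f a - y0) + norm (f b - (y0 + z))"
      by (metis norm_triangle_ineq4)
    with a b have "norm (z - f (b - a)) \<le> e" by (simp add: dist_norm)
    moreover have "norm (b - a) \<le> 2 * real n"
      using norm_triangle_ineq4[of b a] a b by simp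
    ultimately show ?thesis by blast
  qed
  define C where "C = 2 * real n / r"
  have C: "C \<ge> 0" using r by (simp add: C_def)
  have approx: "\<exists>x. norm x \<le> C * norm y \<and> norm (y - f x) \<le> norm y / 2" for y
  proof (cases "y = 0")
    case True
    then show ?thesis by (intro exI[of _ 0]) (simp add: f.zero)
  next
    case False
    define c where "c = norm y / r"
    have c: "c > 0" using False r by (simp add: c_def)
    obtain x where x: "norm x \<le> 2 * real n" "norm (y /\<^sub>R c - f x) \<le> r / 2"
      using near[of "y /\<^sub>R c" "r/2"] False r by (auto simp: c_def)
    have "y - f (c *\<^sub>R x) = c *\<^sub>R (y /\<^sub>R c - f x)"
      using c by (simp add: f.scaleR scaleR_diff_right)
    then have "norm (y - f (c *\<^sub>R x)) \<le> c * (r / 2)"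
      using x c by simp
    moreover have "norm (c *\<^sub>R x) \<le> C * norm y"
      using mult_left_mono[OF x(1), of c] c r by (simp add: c_def C_def field_simps)
    ultimately show ?thesis
      using r by (intro exI[of _ "c *\<^sub>R x"]) (simp add: c_def)
  qed
  have "\<forall>y. \<exists>x. f x = y \<and> norm x \<le> (2 * C) * norm y"
    using exact_preimage_of_approximate_preimages[OF f approx C] by blast
  then show ?thesis using C by (intro exI[of _ "2 * C"]) simp
qed

lemma bounded_linear_inv:
  fixes f :: "'a::banach \<Rightarrow> 'b::banach"
  assumes f: "bounded_linear f" and bij: "bij f"
  shows "bounded_linear (inv f)"
proof -
  interpret f: bounded_linear f by (fact f)
  have inv: "f (inv f y) = y" "inv f (f x) = x" for x y
    using bij by (simp_all add: bij_is_surj surj_f_inv_f bij_is_inj)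
  obtain C where C: "\<And>y. \<exists>x. f x = y \<and> norm x \<le> C * norm y"
    using open_mapping_estimate[OF f bij_is_surj[OF bij]] by blast
  show ?thesis
  proof (rule bounded_linear_intro)
    show "inv f (x + y) = inv f x + inv f y" for x y
      by (metis f.add inv)
    show "inv f (c *\<^sub>R x) = c *\<^sub>R inv f x" for c x
      by (metis f.scaleR inv)
    show "norm (inv f y) \<le> norm y * C" for y
      using C[of y] inv(2) by (auto simp: mult.commute)
  qed
qed

section \<open>Complex-linear operators and closed subspaces\<close>

lemma clinear_op_iff:
  "clinear_op f \<longleftrightarrow> (\<forall>c x. blinfun_apply f (c *\<^sub>C x) = c *\<^sub>C blinfun_apply f x)"
  using vector_space_scaleC[where ?'a = 'a] vector_space_scaleC[where ?'a = 'b]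
  by (auto simp: clinear_op_def Vector_Spaces.linear_iff blinfun.add_right)

lemma scaleC_diff_right: "c *\<^sub>C (x - y) = c *\<^sub>C x - c *\<^sub>C (y :: 'a :: complex_banach)"
  using module.scale_right_diff_distrib[OF vector_space_scaleC[unfolded module_iff_vector_space[symmetric]]] .

lemma clinear_op_simps [simp]:
  "clinear_op id_blinfun"
  "clinear_op f \<Longrightarrow> clinear_op g \<Longrightarrow> clinear_op (f + g)"
  "clinear_op f \<Longrightarrow> clinear_op g \<Longrightarrow> clinear_op (f - g)"
  "clinear_op f \<Longrightarrow> clinear_op h \<Longrightarrow> clinear_op (f \<cdot> h)"
  by (simp_all add: clinear_op_iff blinfun.add_left blinfun.diff_left scaleC_add_right scaleC_diff_right)

lemma closed_csubspaceD:
  assumes "closed_csubspace M"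
  shows "closed M" "subspace M" "0 \<in> M"
    "x \<in> M \<Longrightarrow> y \<in> M \<Longrightarrow> x + y \<in> M" "x \<in> M \<Longrightarrow> y \<in> M \<Longrightarrow> x - y \<in> M"
    "x \<in> M \<Longrightarrow> c *\<^sub>C x \<in> M" "x \<in> M \<Longrightarrow> r *\<^sub>R x \<in> M"
proof -
  have mod: "module (scaleC :: complex \<Rightarrow> 'a \<Rightarrow> 'a)"
    using vector_space_scaleC by (simp add: module_iff_vector_space)
  have M: "closed M" "module.subspace scaleC M"
    using assms by (auto simp: closed_csubspace_def)
  show "closed M" by (fact M)
  show "0 \<in> M" "x \<in> M \<Longrightarrow> y \<in> M \<Longrightarrow> x + y \<in> M" "x \<in> M \<Longrightarrow> y \<in> M \<Longrightarrow> x - y \<in> M"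
    "x \<in> M \<Longrightarrow> c *\<^sub>C x \<in> M"
    using M(2) module.subspace_0[OF mod] module.subspace_add[OF mod] module.subspace_diff[OF mod]
      module.subspace_scale[OF mod] by blast+
  have R: "x \<in> M \<Longrightarrow> r *\<^sub>R x \<in> M" for x r
    using module.subspace_scale[OF mod M(2), of x "complex_of_real r"] by (simp add: scaleC_of_real)
  then show "x \<in> M \<Longrightarrow> r *\<^sub>R x \<in> M" .
  show "subspace M"
    unfolding subspace_def
    using module.subspace_0[OF mod M(2)] module.subspace_add[OF mod M(2)] R by blast
qed

section \<open>Distances to subspaces and the gap\<close>

lemma infdist_greatest:
  assumes "N \<noteq> {}" "\<And>n. n \<in> N \<Longrightarrow> c \<le> dist x n"
  shows "c \<le> infdist x N"
  using assms by (auto simp: infdist_notempty intro: cINF_greatest)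

lemma infdist_le_norm: "0 \<in> N \<Longrightarrow> infdist x N \<le> norm x"
  using infdist_le[of 0 N x] by simp

text \<open>
  The gap is a supremum over unit vectors; homogeneity of the distance to a subspace extends the
  bound to all vectors, and this is the only form in which the gap enters the estimates.
\<close>

lemma infdist_le_gap_delta:
  assumes M: "closed_csubspace M" and N: "closed_csubspace N" and x: "x \<in> M"
  shows "infdist x N \<le> gap_delta M N * norm x"
proof (cases "x = 0")
  case True
  then show ?thesis using closed_csubspaceD(3)[OF N] by simp
next
  case False
  define u where "u = x /\<^sub>R norm x"
  have u: "u \<in> M" "norm u = 1"
    using False closed_csubspaceD(7)[OF M x] by (simp_all add: u_def)
  have "infdist u N \<le> (SUP x\<in>{x\<in>M. norm x = 1}. infdist x N)"
  proof (rule cSUP_upper)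
    show "bdd_above ((\<lambda>x. infdist x N) ` {x \<in> M. norm x = 1})"
      using infdist_le_norm[OF closed_csubspaceD(3)[OF N]] by (intro bdd_aboveI2[where M = 1]) (metis (mono_tags, lifting) mem_Collect_eq)
  qed (use u in simp)
  also have "\<dots> = gap_delta M N"
    using False x by (auto simp: gap_delta_def)
  finally have u_le: "infdist u N \<le> gap_delta M N" .
  have "infdist x N / norm x \<le> infdist u N"
  proof (rule infdist_greatest)
    fix n assume n: "n \<in> N"
    have "infdist x N \<le> dist x (norm x *\<^sub>R n)"
      using closed_csubspaceD(7)[OF N n] by (rule infdist_le)
    also have "\<dots> = norm (norm x *\<^sub>R (u - n))"
      using False by (simp add: u_def dist_norm scaleR_diff_right)
    also have "\<dots> = norm x * dist u n" by (simp add: dist_norm)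
    finally show "infdist x N / norm x \<le> dist u n"
      using False by (simp add: field_simps)
  qed (use closed_csubspaceD(3)[OF N] in blast)
  with u_le have "infdist x N / norm x \<le> gap_delta M N" by simp
  then show ?thesis using False by (simp add: field_simps)
qed

lemma gap_commute: "gap M N = gap N M"
  by (simp add: gap_def max.commute)

lemma infdist_le_gap:
  assumes M: "closed_csubspace M" and N: "closed_csubspace N" and x: "x \<in> M"
  shows "infdist x N \<le> gap M N * norm x"
  using infdist_le_gap_delta[OF assms] mult_right_mono[of "gap_delta M N" "gap M N" "norm x"]
  by (simp add: gap_def)

lemma gap_delta_nonneg:
  assumes "closed_csubspace M" "closed_csubspace N"
  shows "0 \<le> gap_delta M N"
proof (cases "M = {0}")
  case False
  then obtain x where x: "x \<in> M" "x \<noteq> 0" using closed_csubspaceD(3)[OF assms(1)] by blast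
  have "0 \<le> gap_delta M N * norm x"
    using infdist_le_gap_delta[OF assms x(1)] infdist_nonneg[of x N] by linarith
  then show ?thesis using x by (simp add: zero_le_mult_iff)
qed (simp add: gap_delta_def)

lemma gap_nonneg:
  assumes "closed_csubspace M" "closed_csubspace N"
  shows "0 \<le> gap M N"
  using gap_delta_nonneg[OF assms] by (simp add: gap_def)

text \<open>
  Subtracting an element of the kernel does not change the image. This turns a distance between
  subspaces into the smallness of an operator without choosing (almost) nearest points.
\<close>

lemma norm_le_infdist_of_kernel:
  fixes L :: "'a::real_normed_vector \<Rightarrow>\<^sub>L 'b::real_normed_vector"
  assumes N: "N \<noteq> {}" "\<And>n. n \<in> N \<Longrightarrow> L n = 0"
  shows "norm (L x) \<le> norm L * infdist x N"
proof (cases "L = 0")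
  case False
  have "norm (L x) / norm L \<le> infdist x N"
  proof (rule infdist_greatest[OF N(1)])
    fix n assume "n \<in> N"
    then have "norm (L x) = norm (L (x - n))"
      by (simp add: blinfun.diff_right N)
    also have "\<dots> \<le> norm L * dist x n" by (simp add: norm_blinfun dist_norm)
    finally show "norm (L x) / norm L \<le> dist x n"
      using False by (simp add: field_simps)
  qed
  then show ?thesis using False by (simp add: field_simps)
qed simp

lemma infdist_sum_le:
  fixes A :: "'a::real_normed_vector \<Rightarrow>\<^sub>L 'b::real_normed_vector"
  assumes M: "M \<noteq> {}" and N: "N \<noteq> {}"
  shows "infdist (A x + y) {A m + n |m n. m \<in> M \<and> n \<in> N}
    \<le> norm A * infdist x M + infdist y N" (is "infdist ?z ?Z \<le> _")
proof (rule field_le_epsilon)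
  fix e :: real assume e: "e > 0"
  \<comment> \<open>Almost nearest points within \<open>d\<close> cost \<open>norm A * d + d = e\<close> in total.\<close>
  define d where "d = e / (norm A + 1)"
  have d: "d > 0" "norm A * d + d = e" 
    using e by (simp_all add: d_def add_pos_nonneg add_nonneg_pos field_simps add_nonneg_eq_0_iff)
  obtain m where m: "m \<in> M" "dist x m < infdist x M + d"
    using infdist_greatest[OF M, of "infdist x M + d" x] d by (meson less_add_same_cancel1 not_le)
  obtain n where n: "n \<in> N" "dist y n < infdist y N + d"
    using infdist_greatest[OF N, of "infdist y N + d" y] d by (meson less_add_same_cancel1 not_le)
  have "infdist ?z ?Z \<le> dist ?z (A m + n)"
    using m n by (intro infdist_le) blast
  also have "\<dots> = norm (A (x - m) + (y - n))"
    by (simp add: dist_norm blinfun.diff_right algebra_simps)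
  also have "\<dots> \<le> norm A * dist x m + dist y n"
    using norm_triangle_ineq norm_blinfun[of A "x - m"] by (metis (no_types, lifting) add_mono dist_norm order.refl order_trans)
  also have "\<dots> \<le> norm A * (infdist x M + d) + (infdist y N + d)"
    using m n by (intro add_mono mult_left_mono) auto
  finally show "infdist ?z ?Z \<le> norm A * infdist x M + infdist y N + e"
    using d by (simp add: algebra_simps)
qed

text \<open>
  A converse of Riesz's lemma: the distance to \<open>Z\<close> does not change under translation by \<open>Z\<close>, so
  the hypothesis applied to \<open>y - z\<close> with \<open>z\<close> almost nearest to \<open>y\<close> makes the distance of \<open>y\<close>
  at most \<open>q\<close> times itself.
\<close>

lemma closed_subspace_eq_UNIV_of_infdist_le:
  assumes Z: "closed Z" "subspace Z" and q: "q < 1" "\<And>y. infdist y Z \<le> q * norm y"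
  shows "Z = UNIV"
proof -
  have ne: "Z \<noteq> {}" using subspace_0[OF Z(2)] by blast
  have "y \<in> Z" for y
  proof (rule ccontr)
    assume "y \<notin> Z"
    then have pos: "infdist y Z > 0"
      using Z(1) ne by (simp add: infdist_pos_not_in_closed)
    have q0: "q \<ge> 0"
    proof -
      have "0 \<le> q * norm y" using q(2)[of y] pos by linarith
      moreover have "y \<noteq> 0" using pos subspace_0[OF Z(2)] by auto
      ultimately show ?thesis by (simp add: zero_le_mult_iff)
    qed
    have "infdist y Z \<le> q * dist y z" if z: "z \<in> Z" for z
    proof -
      have "infdist y Z \<le> infdist (y - z) Z"
      proof (rule infdist_greatest[OF ne])
        fix w assume "w \<in> Z"
        then have "infdist y Z \<le> dist y (z + w)"
          using z Z(2) by (intro infdist_le subspace_add)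
        then show "infdist y Z \<le> dist (y - z) w" by (simp add: dist_norm algebra_simps)
      qed
      then show ?thesis using q(2)[of "y - z"] by (simp add: dist_norm)
    qed
    then have "q > 0 \<Longrightarrow> infdist y Z / q \<le> infdist y Z"
      by (intro infdist_greatest[OF ne]) (simp add: field_simps)
    moreover have "q \<noteq> 0" using q(2)[of y] pos by auto
    ultimately have "infdist y Z \<le> q * infdist y Z" using q0 by (simp add: field_simps)
    then show False using pos q(1) by simp
  qed
  then show ?thesis by blast
qed

section \<open>Existence of outer inverses\<close>

text \<open>
  Existence of an outer inverse amounts to the decomposition of the codomain into \<open>A T\<close> and \<open>S\<close>,
  with control of the component in \<open>T\<close>. The lower bound makes the sum of the two direct and closed,
  the distance condition makes it everything, and the operator sends \<open>A t + s\<close> to \<open>t\<close>.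
\<close>

lemma outer_inverse_exists_of_bounded_below:
  fixes A :: "'a::complex_banach \<Rightarrow>\<^sub>L 'b::complex_banach"
  assumes A: "clinear_op A" and T: "closed_csubspace T" and S: "closed_csubspace S"
    and lower: "\<And>t s. t \<in> T \<Longrightarrow> s \<in> S \<Longrightarrow> norm t \<le> c * norm (A t + s)"
    and q: "q < 1" "\<And>y. infdist y {A t + s |t s. t \<in> T \<and> s \<in> S} \<le> q * norm y"
  obtains G where "is_outer_inverse A T S G" "\<And>y. norm (G y) \<le> c * norm y"
proof -
  note T' = closed_csubspaceD[OF T] and S' = closed_csubspaceD[OF S]
  let ?Z = "{A t + s |t s. t \<in> T \<and> s \<in> S}"
  define f where "f p = A (fst p) + snd p" for p :: "'a \<times> 'b"
  have f: "bounded_linear f"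
    unfolding f_def by (intro bounded_linear_add bounded_linear_compose[OF blinfun.bounded_linear_right]
        bounded_linear_fst bounded_linear_snd)
  have Z: "?Z = f ` (T \<times> S)" by (force simp: f_def image_iff)
  \<comment> \<open>The lower bound for \<open>t\<close> gives one for \<open>s = f (t, s) - A t\<close>; the two summands bound \<open>t\<close> and \<open>s\<close>.\<close>
  define k where "k = \<bar>c\<bar> + (1 + norm A * \<bar>c\<bar>)"
  have k: "k > 0" unfolding k_def by (smt (verit) mult_nonneg_nonneg norm_ge_zero)
  have "complete ?Z"
    unfolding Z
  proof (rule complete_isometric_image[OF _ _ f])
    show "0 < 1 / k" using k by simp
    show "subspace (T \<times> S)" using T' S' by (intro subspace_Times)
    show "complete (T \<times> S)" using T' S' by (simp add: complete_eq_closed closed_Times)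
    have "norm (t, s) \<le> k * norm (f (t, s))" if "t \<in> T" "s \<in> S" for t s
    proof -
      have t: "norm t \<le> \<bar>c\<bar> * norm (f (t, s))"
        using lower[OF that] by (simp add: f_def) (smt (verit) mult_right_mono norm_ge_zero)
      have "norm s = norm (f (t, s) - A t)" by (simp add: f_def)
      also have "\<dots> \<le> norm (f (t, s)) + norm A * norm t"
        using norm_triangle_ineq4[of "f (t, s)" "A t"] norm_blinfun[of A t] by linarith
      also have "\<dots> \<le> norm (f (t, s)) + norm A * (\<bar>c\<bar> * norm (f (t, s)))"
        using t by (simp add: mult_left_mono)
      finally have "norm t + norm s \<le> k * norm (f (t, s))"
        using t by (simp add: k_def algebra_simps)
      then show ?thesis using norm_Pair_le[of t s] by linarith
    qed
    then show "\<forall>x\<in>T \<times> S. 1 / k * norm x \<le> norm (f x)"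
      using k by (auto simp: field_simps)
  qed
  then have "closed ?Z" by (rule complete_imp_closed)
  moreover have "subspace ?Z"
    unfolding Z using f T' S' by (intro linear_subspace_image bounded_linear.linear subspace_Times)
  ultimately have Z_UNIV: "?Z = UNIV"
    by (rule closed_subspace_eq_UNIV_of_infdist_le[OF _ _ q])
  have ex: "\<exists>t. t \<in> T \<and> y - A t \<in> S" for y
  proof -
    have "y \<in> ?Z" unfolding Z_UNIV ..
    then show ?thesis by force
  qed
  then obtain g where g: "\<And>y. g y \<in> T" "\<And>y. y - A (g y) \<in> S" by metis
  have g_le: "norm (g y) \<le> c * norm y" for y
    using lower[OF g(1) g(2), of y y] by simp
  have g_eq: "g y = t" if t: "t \<in> T" "y - A t \<in> S" for y t
  proof -
    have "A (g y) - A t \<in> S"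
      using S'(5)[OF t(2) g(2)[of y]] by simp
    then have "- (A (g y) - A t) \<in> S"
      using S'(5)[OF S'(3)] by (metis diff_0)
    then have "norm (g y - t) \<le> c * norm (A (g y - t) - (A (g y) - A t))"
      using lower[OF T'(5)[OF g(1) t(1)]] by (metis uminus_add_conv_diff add.commute)
    then show ?thesis by (simp add: blinfun.diff_right)
  qed
  have g_add: "g (x + y) = g x + g y" for x y
  proof (rule g_eq)
    show "x + y - A (g x + g y) \<in> S"
      using S'(4)[OF g(2)[of x] g(2)[of y]] by (simp add: blinfun.add_right algebra_simps)
  qed (intro T' g)
  have g_scaleC: "g (a *\<^sub>C y) = a *\<^sub>C g y" for a y
  proof (rule g_eq)
    show "a *\<^sub>C y - A (a *\<^sub>C g y) \<in> S"
      using S'(6)[OF g(2)[of y], of a] A by (simp add: scaleC_diff_right clinear_op_iff)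
  qed (intro T' g)
  have bl: "bounded_linear g"
  proof (rule bounded_linear_intro[where K = c])
    show "g (r *\<^sub>R y) = r *\<^sub>R g y" for r y
      using g_scaleC[of "complex_of_real r" y] by (simp add: scaleC_of_real)
  qed (use g_add g_le in \<open>auto simp: mult.commute\<close>)
  define G where "G = Blinfun g"
  have G: "blinfun_apply G = g" by (simp add: G_def bounded_linear_Blinfun_apply[OF bl])
  have fix_T: "g (A t) = t" if "t \<in> T" for t
    by (rule g_eq) (use that S' in auto)
  have "is_outer_inverse A T S G"
    unfolding is_outer_inverse_def
  proof (intro conjI)
    show "clinear_op G" by (simp add: clinear_op_iff G g_scaleC)
    show "G \<cdot> A \<cdot> G = G" by (rule blinfun_eqI) (simp add: G fix_T g)
    show "op_range G = T" using fix_T g(1) unfolding op_range_def G by (metis image_subsetI rangeI subsetI subset_antisym)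
    show "op_kernel G = S"
    proof (intro set_eqI iffI)
      fix y
      show "y \<in> op_kernel G" if "y \<in> S"
        using g_eq[of 0 y] that T' by (simp add: op_kernel_def G)
      show "y \<in> S" if "y \<in> op_kernel G"
        using g(2)[of y] that by (simp add: op_kernel_def G)
    qed
  qed
  then show thesis by (rule that) (simp only: G g_le)
qed

section \<open>Group inverses of products\<close>

lemma outer_inverse_eqI: "is_outer_inverse A T S G \<Longrightarrow> outer_inverse A T S = G"
  unfolding outer_inverse_def by (rule the_equality) (auto intro: is_outer_inverse_unique)

lemma op_inverse_eqI: "is_op_inverse C D \<Longrightarrow> op_inverse C = D"
  unfolding op_inverse_def by (rule the_equality) (auto intro: is_op_inverse_unique)

lemma group_inverse_eqI: "is_group_inverse C D \<Longrightarrow> group_inverse C = D"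
  unfolding group_inverse_def by (rule the_equality) (auto intro: is_group_inverse_unique)

lemma is_op_inverseI:
  fixes C D :: "'a::complex_banach \<Rightarrow>\<^sub>L 'a"
  assumes "clinear_op D"
    "\<And>x. C (D x) = x" "\<And>x. D (C x) = x"
  shows "is_op_inverse C D"
  using assms by (auto simp: is_op_inverse_def intro: blinfun_eqI)

text \<open>
  \<open>B \<cdot> A\<close> is a projection onto \<open>T\<close>, hence a left unit for every operator with range \<open>T\<close>. Dually,
  \<open>A \<cdot> B\<close> is a projection along \<open>S\<close>, hence a right unit for every operator with kernel \<open>S\<close>. All
  operator identities below are rewriting with these two rules.
\<close>

lemma outer_inverse_left_unit:
  fixes A :: "'a::complex_banach \<Rightarrow>\<^sub>L 'b::complex_banach" and B H :: "'b \<Rightarrow>\<^sub>L 'a"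
  assumes B: "is_outer_inverse A T S B" and H: "op_range H = T"
  shows "B (A (H y)) = H y"
proof -
  have "H y \<in> op_range B"
    using B H by (auto simp: is_outer_inverse_def op_range_def)
  then obtain z where "H y = B z" by (auto simp: op_range_def)
  moreover have "blinfun_apply (B \<cdot> A \<cdot> B) z = B z"
    using B by (simp only: is_outer_inverse_def)
  ultimately show ?thesis by simp
qed

lemma outer_inverse_right_unit:
  fixes A :: "'a::complex_banach \<Rightarrow>\<^sub>L 'b::complex_banach" and B :: "'b \<Rightarrow>\<^sub>L 'a"
    and H :: "'b \<Rightarrow>\<^sub>L 'c::complex_banach"
  assumes B: "is_outer_inverse A T S B" and H: "op_kernel H = S"
  shows "H (A (B y)) = H y"
proof -
  have "blinfun_apply (B \<cdot> A \<cdot> B) y = B y"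
    using B by (simp only: is_outer_inverse_def)
  then have "y - A (B y) \<in> op_kernel B"
    by (simp add: op_kernel_def blinfun.diff_right)
  then have "y - A (B y) \<in> op_kernel H"
    using B H by (simp add: is_outer_inverse_def)
  then show ?thesis by (simp add: op_kernel_def blinfun.diff_right)
qed

lemma bij_op_invertible:
  fixes C :: "'a::complex_banach \<Rightarrow>\<^sub>L 'a"
  assumes C: "clinear_op C" and bij: "bij (blinfun_apply C)"
  obtains D where "is_op_inverse C D"
proof -
  have inv: "C (inv (blinfun_apply C) y) = y"
    "inv (blinfun_apply C) (C y) = y" for y
    using bij by (simp_all add: bij_is_surj surj_f_inv_f bij_is_inj)
  define D where "D = Blinfun (inv (blinfun_apply C))"
  have D: "blinfun_apply D = inv (blinfun_apply C)"
    unfolding D_def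
    by (rule bounded_linear_Blinfun_apply[OF bounded_linear_inv[OF blinfun.bounded_linear_right bij]])
  have "clinear_op D"
    using C unfolding clinear_op_iff D by (metis inv)
  then have "is_op_inverse C D"
    by (rule is_op_inverseI) (simp_all add: D inv)
  then show thesis by (rule that)
qed

text \<open>
  Since \<open>A \<cdot> B\<close> is the projection onto \<open>A T\<close> along \<open>S\<close>, and \<open>A \<cdot> G\<close> maps \<open>A T\<close> bijectively onto
  itself and vanishes on \<open>S\<close>, replacing the zero on \<open>S\<close> by the identity yields a bijection \<open>M\<close> of
  the whole space. Its bounded inverse, cut down by \<open>A \<cdot> B\<close>, is the group inverse. The last three
  equations say that \<open>B = G \<cdot> W\<close>, that \<open>W \<cdot> A \<cdot> G\<close> is the projection \<open>A \<cdot> B\<close>, and that \<open>W\<close> has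
  its range in \<open>A T\<close>.
\<close>

lemma group_inverse_of_product:
  fixes A :: "'a::complex_banach \<Rightarrow>\<^sub>L 'b::complex_banach" and B G :: "'b \<Rightarrow>\<^sub>L 'a"
  assumes A: "clinear_op A" and B: "is_outer_inverse A T S B"
    and G: "clinear_op G" "op_range G = T" "op_kernel G = S"
  defines "W \<equiv> group_inverse (A \<cdot> G)"
  shows "is_group_inverse (A \<cdot> G) W" "op_kernel W = S"
    "G (W y) = B y" "W (A (G y)) = A (B y)" "A (B (W y)) = W y"
proof -
  have Bc: "clinear_op B" using B by (simp add: is_outer_inverse_def)
  have BB: "B (A (B y)) = B y" for y
    by (rule outer_inverse_left_unit[OF B]) (use B in \<open>simp add: is_outer_inverse_def\<close>)
  have BG: "B (A (G y)) = G y" for y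
    by (rule outer_inverse_left_unit[OF B G(2)])
  have GB: "G (A (B y)) = G y" for y
    by (rule outer_inverse_right_unit[OF B G(3)])
  have B0: "B y = 0" if "G y = 0" for y
  proof -
    have "y \<in> op_kernel G" using that by (simp add: op_kernel_def)
    then have "y \<in> op_kernel B" using B G by (simp add: is_outer_inverse_def)
    then show ?thesis by (simp add: op_kernel_def)
  qed
  note lin = blinfun.add_left blinfun.diff_left blinfun.add_right blinfun.diff_right
  define M where "M = A \<cdot> G + (id_blinfun - A \<cdot> B)"
  have M: "M y =
      A (G y) + (y - A (B y))" for y
    by (simp add: M_def lin)
  have "bij (blinfun_apply M)"
  proof (rule bijI)
    show "inj (blinfun_apply M)"
    proof (rule injI)
      fix x y assume "M x = M y"
      then have M0: "M (x - y) = 0" by (simp add: lin)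
      define z where "z = x - y"
      have z: "A (G z) + (z - A (B z)) = 0"
        using M0 by (simp only: M z_def)
      then have "B (A (G z) + (z - A (B z))) = 0"
        by (simp only: blinfun.zero_right)
      then have "G z = 0" by (simp add: lin BG BB)
      with z B0[OF this] have "z = 0" by simp
      then show "x = y" by (simp add: z_def)
    qed
    show "surj (blinfun_apply M)"
    proof (rule surjI)
      fix y
      have "B y \<in> op_range G"
        using B G by (auto simp: is_outer_inverse_def op_range_def)
      then have "\<exists>z. G z = B y" by (auto simp: op_range_def)
      then have z: "G (SOME z. G z = B y) = B y"
        by (rule someI_ex)
      \<comment> \<open>On \<open>A T\<close> a preimage comes from the range of \<open>G\<close>, on \<open>S\<close> the point is its own preimage.\<close>
      show "M (A (B (SOME z. G z = B y))
          + (y - A (B y))) = y"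
        by (simp add: M lin GB BB z)
    qed
  qed
  moreover have "clinear_op M" using A Bc G by (simp add: M_def)
  ultimately obtain N where "is_op_inverse M N" using bij_op_invertible by blast
  then have N: "clinear_op N" "M (N y) = y"
    "N (M y) = y" for y
    unfolding is_op_inverse_def
    by (auto simp flip: blinfun_apply_blinfun_compose)
  have MP: "M (A (B y)) = A (G y)" for y
    by (simp add: M BB GB)
  have PM: "A (B (M y)) = A (G y)" for y
    by (simp add: M lin BB BG)
  have NAG: "N (A (G y)) = A (B y)" for y
    by (metis MP N(3))
  have NP: "N (A (B y)) = A (B (N y))" for y
    by (metis MP PM N(2,3))
  have GN: "G (N y) = B y" for y
    by (metis PM BB BG N(2))
  define W' where "W' = N \<cdot> (A \<cdot> B)"
  have W: "W' y = A (B (N y))" for y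
    by (simp add: W'_def NP)
  have GW: "G (W' y) = B y" for y
    by (simp add: W GB GN)
  have WAG: "W' (A (G y)) = A (B y)" for y
    by (simp add: W NAG BB)
  have PW: "A (B (W' y)) = W' y" for y
    by (simp add: W BB)
  have WP: "W' (A (B y)) = W' y" for y
    by (simp add: W'_def BB)
  have group: "is_group_inverse (A \<cdot> G) W'"
    unfolding is_group_inverse_def
  proof (intro conjI)
    show "clinear_op W'" using A Bc N(1) by (simp add: W'_def)
  qed (auto intro!: blinfun_eqI simp: GW WAG WP PW GB)
  have ker: "op_kernel W' = S"
  proof -
    have "op_kernel B = S" using B by (simp add: is_outer_inverse_def)
    moreover have "W' y = 0 \<longleftrightarrow> B y = 0" for y
      by (metis GW WP blinfun.zero_right)
    ultimately show ?thesis by (simp add: op_kernel_def)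
  qed
  have "W = W'" unfolding W_def by (rule group_inverse_eqI[OF group])
  then show "is_group_inverse (A \<cdot> G) W" "op_kernel W = S"
    "G (W y) = B y" "W (A (G y)) = A (B y)" "A (B (W y)) = W y"
    using group ker GW WAG PW by simp_all
qed

section \<open>The representation formula\<close>

lemmas blinfun_linear = blinfun.add_left blinfun.diff_left blinfun.add_right blinfun.diff_right

text \<open>
  Passage from \<open>T\<close> to \<open>T'\<close> with the kernel \<open>S\<close> kept. In the decomposition of the space into \<open>A T\<close>
  and \<open>S\<close>, the operator \<open>id_blinfun + A \<cdot> F \<cdot> W = id_blinfun - A \<cdot> B + A \<cdot> G\<^sub>1 \<cdot> W\<close> is the identity
  on \<open>S\<close> and carries \<open>A T\<close> onto \<open>A T'\<close>; exchanging the roles of \<open>T\<close> and \<open>T'\<close> gives its inverse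
  \<open>D\<^sub>3\<close>. Likewise \<open>id_blinfun + W \<cdot> A \<cdot> F = id_blinfun - A \<cdot> B + W \<cdot> A \<cdot> G\<^sub>1\<close> preserves both
  summands; \<open>D\<^sub>1\<close> inverts it on \<open>A T\<close> by \<open>A \<cdot> G\<close>, then the group inverse belonging to \<open>A T'\<close>,
  then the projection back to \<open>A T\<close>.
\<close>

lemma change_of_range:
  fixes A :: "'a::complex_banach \<Rightarrow>\<^sub>L 'b::complex_banach" and B B\<^sub>1 G G\<^sub>1 :: "'b \<Rightarrow>\<^sub>L 'a"
  assumes A: "clinear_op A"
    and B: "is_outer_inverse A T S B" and B\<^sub>1: "is_outer_inverse A T' S B\<^sub>1"
    and G: "clinear_op G" "op_range G = T" "op_kernel G = S"
    and G\<^sub>1: "clinear_op G\<^sub>1" "op_range G\<^sub>1 = T'" "op_kernel G\<^sub>1 = S"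
  defines "F \<equiv> G\<^sub>1 - G" and "W \<equiv> group_inverse (A \<cdot> G)" and "W\<^sub>1 \<equiv> group_inverse (A \<cdot> G\<^sub>1)"
  defines "D\<^sub>1 \<equiv> id_blinfun - A \<cdot> B + A \<cdot> B \<cdot> W\<^sub>1 \<cdot> A \<cdot> G"
    and "D\<^sub>3 \<equiv> id_blinfun - A \<cdot> B\<^sub>1 + A \<cdot> G \<cdot> W\<^sub>1"
  shows "is_op_inverse (id_blinfun + W \<cdot> A \<cdot> F) D\<^sub>1"
    and "is_op_inverse (id_blinfun + A \<cdot> F \<cdot> W) D\<^sub>3"
    and "B + (id_blinfun - B \<cdot> A) \<cdot> F \<cdot> D\<^sub>1 \<cdot> W = B\<^sub>1"
    and "(id_blinfun - A \<cdot> B) \<cdot> D\<^sub>3 = id_blinfun - A \<cdot> B\<^sub>1"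
proof -
  note W = group_inverse_of_product[OF A B G, folded W_def]
  note W\<^sub>1 = group_inverse_of_product[OF A B\<^sub>1 G\<^sub>1, folded W\<^sub>1_def]
  have ops: "clinear_op B" "op_range B = T" "op_kernel B = S"
    "clinear_op B\<^sub>1" "op_range B\<^sub>1 = T'" "op_kernel B\<^sub>1 = S" "clinear_op W" "clinear_op W\<^sub>1"
    using B B\<^sub>1 W(1) W\<^sub>1(1) by (auto simp: is_outer_inverse_def is_group_inverse_def)
  note units = outer_inverse_left_unit[OF B] outer_inverse_left_unit[OF B\<^sub>1]
    outer_inverse_right_unit[OF B] outer_inverse_right_unit[OF B\<^sub>1]
  note rules = blinfun_linear F_def D\<^sub>1_def D\<^sub>3_def A G G\<^sub>1 ops W W\<^sub>1 units
  show "is_op_inverse (id_blinfun + W \<cdot> A \<cdot> F) D\<^sub>1"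
    and "is_op_inverse (id_blinfun + A \<cdot> F \<cdot> W) D\<^sub>3"
    by (rule is_op_inverseI; simp add: rules)+
  show "B + (id_blinfun - B \<cdot> A) \<cdot> F \<cdot> D\<^sub>1 \<cdot> W = B\<^sub>1"
    and "(id_blinfun - A \<cdot> B) \<cdot> D\<^sub>3 = id_blinfun - A \<cdot> B\<^sub>1"
    by (rule blinfun_eqI; simp add: rules)+
qed

text \<open>
  Passage from \<open>S\<close> to \<open>S'\<close> with the range kept. Here
  \<open>id_blinfun + W\<^sub>1 \<cdot> A \<cdot> F = id_blinfun - A \<cdot> B\<^sub>1 + W\<^sub>1 \<cdot> A \<cdot> G\<^sub>2\<close> is triangular with respect to \<open>A T\<close>
  and \<open>S\<close>. Its inverse is \<open>W\<^sub>2 \<cdot> A \<cdot> G\<^sub>1\<close> on \<open>A T\<close>; for \<open>s\<close> in \<open>S\<close> the preimage must lie in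
  \<open>s + A T\<close> and in the kernel \<open>S'\<close> of \<open>W\<^sub>1 \<cdot> A \<cdot> G\<^sub>2\<close>, so it is \<open>s - A (B\<^sub>2 s)\<close>.
\<close>

lemma change_of_kernel:
  fixes A :: "'a::complex_banach \<Rightarrow>\<^sub>L 'b::complex_banach" and B\<^sub>1 B\<^sub>2 G\<^sub>1 G\<^sub>2 :: "'b \<Rightarrow>\<^sub>L 'a"
  assumes A: "clinear_op A"
    and B\<^sub>1: "is_outer_inverse A T S B\<^sub>1" and B\<^sub>2: "is_outer_inverse A T S' B\<^sub>2"
    and G\<^sub>1: "clinear_op G\<^sub>1" "op_range G\<^sub>1 = T" "op_kernel G\<^sub>1 = S"
    and G\<^sub>2: "clinear_op G\<^sub>2" "op_range G\<^sub>2 = T" "op_kernel G\<^sub>2 = S'"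
  defines "F \<equiv> G\<^sub>2 - G\<^sub>1" and "W\<^sub>1 \<equiv> group_inverse (A \<cdot> G\<^sub>1)" and "W\<^sub>2 \<equiv> group_inverse (A \<cdot> G\<^sub>2)"
  defines "D\<^sub>2 \<equiv> id_blinfun - A \<cdot> B\<^sub>2 + W\<^sub>2 \<cdot> A \<cdot> G\<^sub>1"
  shows "is_op_inverse (id_blinfun + W\<^sub>1 \<cdot> A \<cdot> F) D\<^sub>2"
    and "B\<^sub>1 + B\<^sub>1 \<cdot> D\<^sub>2 \<cdot> W\<^sub>1 \<cdot> A \<cdot> F \<cdot> (id_blinfun - A \<cdot> B\<^sub>1) = B\<^sub>2"
proof -
  note W\<^sub>1 = group_inverse_of_product[OF A B\<^sub>1 G\<^sub>1, folded W\<^sub>1_def]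
  note W\<^sub>2 = group_inverse_of_product[OF A B\<^sub>2 G\<^sub>2, folded W\<^sub>2_def]
  have ops: "clinear_op B\<^sub>1" "op_range B\<^sub>1 = T" "op_kernel B\<^sub>1 = S"
    "clinear_op B\<^sub>2" "op_range B\<^sub>2 = T" "op_kernel B\<^sub>2 = S'" "clinear_op W\<^sub>1" "clinear_op W\<^sub>2"
    using B\<^sub>1 B\<^sub>2 W\<^sub>1(1) W\<^sub>2(1) by (auto simp: is_outer_inverse_def is_group_inverse_def)
  note units = outer_inverse_left_unit[OF B\<^sub>1] outer_inverse_left_unit[OF B\<^sub>2]
    outer_inverse_right_unit[OF B\<^sub>1] outer_inverse_right_unit[OF B\<^sub>2]
  have cross: "A (B\<^sub>2 (W\<^sub>1 y)) = W\<^sub>1 y" "A (B\<^sub>1 (W\<^sub>2 y)) = W\<^sub>2 y" for y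
    using W\<^sub>1(5)[of y] W\<^sub>2(5)[of y] units(1,2) ops by metis+
  note rules = blinfun_linear F_def D\<^sub>2_def A G\<^sub>1 G\<^sub>2 ops W\<^sub>1 W\<^sub>2 units cross
  show "is_op_inverse (id_blinfun + W\<^sub>1 \<cdot> A \<cdot> F) D\<^sub>2"
    by (rule is_op_inverseI; simp add: rules)
  show "B\<^sub>1 + B\<^sub>1 \<cdot> D\<^sub>2 \<cdot> W\<^sub>1 \<cdot> A \<cdot> F \<cdot> (id_blinfun - A \<cdot> B\<^sub>1) = B\<^sub>2"
    by (rule blinfun_eqI; simp add: rules)
qed

text \<open>
  With range and kernel unchanged, the units of \<open>B\<close> and \<open>C\<close> give
  \<open>B \<cdot> E \<cdot> C = B - C = C \<cdot> E \<cdot> B\<close>, which is all that both claims say.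
\<close>

lemma outer_inverse_of_sum:
  fixes A E :: "'a::complex_banach \<Rightarrow>\<^sub>L 'b::complex_banach" and B C :: "'b \<Rightarrow>\<^sub>L 'a"
  assumes E: "clinear_op E"
    and B: "is_outer_inverse A T S B" and C: "is_outer_inverse (A + E) T S C"
  shows "is_op_inverse (id_blinfun + B \<cdot> E) (id_blinfun - C \<cdot> E)"
    and "(id_blinfun - C \<cdot> E) \<cdot> B = C"
proof -
  have ops: "op_range B = T" "op_kernel B = S" "op_range C = T" "op_kernel C = S" "clinear_op C"
    using B C by (auto simp: is_outer_inverse_def)
  have BEC: "B (E (C y)) = B y - C y" for y
    using outer_inverse_right_unit[OF C ops(2), of y] outer_inverse_left_unit[OF B ops(3), of y]
    by (simp add: blinfun_linear algebra_simps)
  have CEB: "C (E (B y)) = B y - C y" for y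
    using outer_inverse_left_unit[OF C ops(1), of y] outer_inverse_right_unit[OF B ops(4), of y]
    by (simp add: blinfun_linear algebra_simps)
  show "is_op_inverse (id_blinfun + B \<cdot> E) (id_blinfun - C \<cdot> E)"
    by (rule is_op_inverseI) (simp_all add: E ops blinfun_linear BEC CEB)
  show "(id_blinfun - C \<cdot> E) \<cdot> B = C"
    by (rule blinfun_eqI) (simp add: blinfun_linear CEB)
qed

text \<open>
  The two changes of subspace are composed: the inner sum of the formula is the outer inverse
  \<open>B\<^sub>1\<close> with range \<open>T'\<close> and kernel \<open>S\<close>, the whole second bracket is the outer inverse \<open>B\<^sub>2\<close> of
  \<open>A\<close> with range \<open>T'\<close> and kernel \<open>S'\<close>, and the first bracket is \<open>id_blinfun + B\<^sub>2 \<cdot> E\<close>.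
\<close>

lemma outer_inverse_representation:
  fixes A E :: "'a::complex_banach \<Rightarrow>\<^sub>L 'b::complex_banach" and B B\<^sub>1 B\<^sub>2 C G Gt Ht :: "'b \<Rightarrow>\<^sub>L 'a"
  assumes A: "clinear_op A" and E: "clinear_op E"
    and B: "is_outer_inverse A T S B" and B\<^sub>1: "is_outer_inverse A T' S B\<^sub>1"
    and B\<^sub>2: "is_outer_inverse A T' S' B\<^sub>2" and C: "is_outer_inverse (A + E) T' S' C"
    and G: "clinear_op G" "op_range G = T" "op_kernel G = S"
    and Gt: "clinear_op Gt" "op_range Gt = T'" "op_kernel Gt = S"
    and Ht: "clinear_op Ht" "op_range Ht = T'" "op_kernel Ht = S'"
  shows "let F = Gt - G;
             Ft = Ht - Gt;
             AGg = group_inverse (A \<cdot> G);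
             AGtg = group_inverse (A \<cdot> Gt);
             J1 = id_blinfun + AGg \<cdot> A \<cdot> F;
             J2 = id_blinfun + AGtg \<cdot> A \<cdot> Ft;
             J3 = id_blinfun + A \<cdot> F \<cdot> AGg;
             K = id_blinfun + B \<cdot> E
               + (id_blinfun - B \<cdot> A) \<cdot> F \<cdot> op_inverse J1 \<cdot> AGg \<cdot> E
               + (B + (id_blinfun - B \<cdot> A) \<cdot> F \<cdot> op_inverse J1 \<cdot> AGg)
                 \<cdot> op_inverse J2 \<cdot> AGtg \<cdot> A \<cdot> Ft \<cdot> (id_blinfun - A \<cdot> B) \<cdot> op_inverse J3 \<cdot> E
         in group_invertible (A \<cdot> G) \<and> group_invertible (A \<cdot> Gt)
          \<and> op_invertible J1 \<and> op_invertible J2 \<and> op_invertible J3 \<and> op_invertible K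
          \<and> C =
              op_inverse K
              \<cdot> (B + (id_blinfun - B \<cdot> A) \<cdot> F \<cdot> op_inverse J1 \<cdot> AGg
                 + (B + (id_blinfun - B \<cdot> A) \<cdot> F \<cdot> op_inverse J1 \<cdot> AGg)
                   \<cdot> op_inverse J2 \<cdot> AGtg \<cdot> A \<cdot> Ft \<cdot> (id_blinfun - A \<cdot> B) \<cdot> op_inverse J3)"
proof -
  define F Ft W W\<^sub>1 where "F = Gt - G" and "Ft = Ht - Gt"
    and "W = group_inverse (A \<cdot> G)" and "W\<^sub>1 = group_inverse (A \<cdot> Gt)"
  note defs = F_def Ft_def W_def W\<^sub>1_def
  define J1 J2 J3 where "J1 = id_blinfun + W \<cdot> A \<cdot> F"
    and "J2 = id_blinfun + W\<^sub>1 \<cdot> A \<cdot> Ft" and "J3 = id_blinfun + A \<cdot> F \<cdot> W"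
  note R = change_of_range[OF A B B\<^sub>1 G Gt, folded defs, folded J1_def J3_def]
  note K = change_of_kernel[OF A B\<^sub>1 B\<^sub>2 Gt Ht, folded defs, folded J2_def]
  note L = outer_inverse_of_sum[OF E B\<^sub>2 C]
  have bracket1: "B + (id_blinfun - B \<cdot> A) \<cdot> F \<cdot> op_inverse J1 \<cdot> W = B\<^sub>1"
    using R(3) by (simp only: op_inverse_eqI[OF R(1)])
  have "op_inverse J2 \<cdot> W\<^sub>1 \<cdot> A \<cdot> Ft \<cdot> (id_blinfun - A \<cdot> B) \<cdot> op_inverse J3
      = op_inverse J2 \<cdot> W\<^sub>1 \<cdot> A \<cdot> Ft \<cdot> (id_blinfun - A \<cdot> B\<^sub>1)"
    using R(4) by (simp only: op_inverse_eqI[OF R(2)] blinfun_compose_assoc)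
  then have bracket2: "B\<^sub>1 + B\<^sub>1 \<cdot> op_inverse J2 \<cdot> W\<^sub>1 \<cdot> A \<cdot> Ft \<cdot> (id_blinfun - A \<cdot> B) \<cdot> op_inverse J3 = B\<^sub>2"
    using K(2) by (simp only: op_inverse_eqI[OF K(1)] blinfun_compose_assoc)
  have "id_blinfun + B \<cdot> E + (id_blinfun - B \<cdot> A) \<cdot> F \<cdot> op_inverse J1 \<cdot> W \<cdot> E
        + B\<^sub>1 \<cdot> op_inverse J2 \<cdot> W\<^sub>1 \<cdot> A \<cdot> Ft \<cdot> (id_blinfun - A \<cdot> B) \<cdot> op_inverse J3 \<cdot> E
      = id_blinfun + (B + (id_blinfun - B \<cdot> A) \<cdot> F \<cdot> op_inverse J1 \<cdot> W
        + B\<^sub>1 \<cdot> op_inverse J2 \<cdot> W\<^sub>1 \<cdot> A \<cdot> Ft \<cdot> (id_blinfun - A \<cdot> B) \<cdot> op_inverse J3) \<cdot> E"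
    by (simp only: bounded_bilinear.add_left[OF bounded_bilinear_blinfun_compose] add.assoc)
  then have outer_factor: "id_blinfun + B \<cdot> E + (id_blinfun - B \<cdot> A) \<cdot> F \<cdot> op_inverse J1 \<cdot> W \<cdot> E
        + B\<^sub>1 \<cdot> op_inverse J2 \<cdot> W\<^sub>1 \<cdot> A \<cdot> Ft \<cdot> (id_blinfun - A \<cdot> B) \<cdot> op_inverse J3 \<cdot> E
      = id_blinfun + B\<^sub>2 \<cdot> E"
    by (simp only: bracket1 bracket2)
  have "group_invertible (A \<cdot> G)" "group_invertible (A \<cdot> Gt)"
    using group_inverse_of_product(1)[OF A B G] group_inverse_of_product(1)[OF A B\<^sub>1 Gt]
    by (auto simp: group_invertible_def)
  moreover have "op_invertible J1" "op_invertible J2" "op_invertible J3"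
    "op_invertible (id_blinfun + B\<^sub>2 \<cdot> E)"
    using R(1,2) K(1) L(1) by (auto simp: op_invertible_def)
  moreover have "C = op_inverse (id_blinfun + B\<^sub>2 \<cdot> E) \<cdot> B\<^sub>2"
    by (simp only: op_inverse_eqI[OF L(1)] L(2))
  ultimately show ?thesis
    unfolding Let_def
    by (simp only: defs[symmetric] J1_def[symmetric] J2_def[symmetric] J3_def[symmetric]
        bracket1 bracket2 outer_factor simp_thms)
qed

section \<open>Perturbation estimates\<close>

text \<open>
  The source of all bounds is the identity \<open>t - B y = (id_blinfun - B \<cdot> A) t - B (E t) - B s\<close>. Since
  \<open>id_blinfun - B \<cdot> A\<close> vanishes on \<open>T\<close> and \<open>B\<close> vanishes on \<open>S\<close>, the first and the last term are
  controlled by the distances of \<open>t\<close> and \<open>s\<close> to these subspaces.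
\<close>

lemma outer_inverse_perturbation_estimate:
  fixes A E :: "'a::complex_banach \<Rightarrow>\<^sub>L 'b::complex_banach" and B :: "'b \<Rightarrow>\<^sub>L 'a"
  assumes B: "is_outer_inverse A T S B" and T: "closed_csubspace T" and S: "closed_csubspace S"
    and t: "infdist t T \<le> \<tau> * norm t" and s: "infdist s S \<le> \<sigma> * norm s" and \<sigma>: "0 \<le> \<sigma>"
  defines "\<kappa> \<equiv> norm A * norm B" and "y \<equiv> (A + E) t + s"
  shows "norm (t - B y) \<le> ((1 + \<kappa>) * \<tau> + \<kappa> * \<sigma> + (1 + \<sigma>) * norm B * norm E) * norm t
    + \<sigma> * norm B * norm y"
proof -
  have BAt: "(id_blinfun - B \<cdot> A) x = 0" if "x \<in> T" for x
  proof -
    have "x \<in> range (blinfun_apply B)" using B that by (simp add: is_outer_inverse_def op_range_def)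
    then obtain z where "x = B z" by blast
    then show ?thesis
      using outer_inverse_left_unit[OF B, of B z] B
      by (simp add: is_outer_inverse_def blinfun_linear)
  qed
  have "norm (id_blinfun - B \<cdot> A) \<le> 1 + \<kappa>"
    using norm_triangle_ineq4[of "id_blinfun :: 'a \<Rightarrow>\<^sub>L 'a" "B \<cdot> A"] norm_blinfun_id_le[where ?'a = 'a]
      norm_blinfun_compose[of B A] by (simp add: \<kappa>_def mult.commute)
  then have "norm ((id_blinfun - B \<cdot> A) t) \<le> (1 + \<kappa>) * (\<tau> * norm t)"
    using norm_le_infdist_of_kernel[of T "id_blinfun - B \<cdot> A" t] BAt closed_csubspaceD(3)[OF T] t
    by (smt (verit) empty_iff infdist_nonneg mult_mono norm_ge_zero)
  moreover have "norm (B (E t)) \<le> norm B * (norm E * norm t)"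
    by (meson mult_left_mono norm_blinfun norm_ge_zero order_trans)
  moreover have "norm (B s) \<le> norm B * (\<sigma> * (norm y + (norm A + norm E) * norm t))"
  proof -
    have "norm s = norm (y - (A t + E t))" by (simp add: y_def blinfun_linear)
    also have "\<dots> \<le> norm y + (norm A + norm E) * norm t"
      using norm_triangle_ineq4[of y "A t + E t"] norm_triangle_ineq[of "A t" "E t"]
        norm_blinfun[of A t] norm_blinfun[of E t] by (simp add: distrib_right)
    finally have "\<sigma> * norm s \<le> \<sigma> * (norm y + (norm A + norm E) * norm t)"
      using \<sigma> by (rule mult_left_mono)
    then have "norm B * infdist s S \<le> norm B * (\<sigma> * (norm y + (norm A + norm E) * norm t))"
      using s by (intro mult_left_mono) auto
    moreover have "norm (B s) \<le> norm B * infdist s S"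
      using B closed_csubspaceD(3)[OF S]
      by (intro norm_le_infdist_of_kernel) (auto simp: is_outer_inverse_def op_kernel_def)
    ultimately show ?thesis by linarith
  qed
  moreover have "norm (t - B y) \<le> norm ((id_blinfun - B \<cdot> A) t) + norm (B (E t)) + norm (B s)"
  proof -
    have "t - B y = (id_blinfun - B \<cdot> A) t - B (E t) - B s"
      by (simp add: y_def blinfun_linear)
    then show ?thesis by (smt (verit) norm_triangle_ineq4)
  qed
  ultimately show ?thesis by (simp add: \<kappa>_def algebra_simps)
qed

lemma outer_inverse_lower_bound:
  fixes A E :: "'a::complex_banach \<Rightarrow>\<^sub>L 'b::complex_banach" and B :: "'b \<Rightarrow>\<^sub>L 'a"
  assumes B: "is_outer_inverse A T S B" and T: "closed_csubspace T" and S: "closed_csubspace S"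
    and t: "infdist t T \<le> \<tau> * norm t" and s: "infdist s S \<le> \<sigma> * norm s" and \<sigma>: "0 \<le> \<sigma>"
  defines "q \<equiv> (1 + norm A * norm B) * \<tau> + norm A * norm B * \<sigma> + (1 + \<sigma>) * norm B * norm E"
  assumes q: "q < 1"
  shows "norm t \<le> (1 + \<sigma>) * norm B / (1 - q) * norm ((A + E) t + s)"
proof -
  let ?y = "(A + E) t + s"
  have "norm t \<le> norm (t - B ?y) + norm (B ?y)"
    using norm_triangle_ineq[of "t - B ?y" "B ?y"] by simp
  also have "\<dots> \<le> q * norm t + \<sigma> * norm B * norm ?y + norm B * norm ?y"
    using outer_inverse_perturbation_estimate[OF assms(1-6), of E] norm_blinfun[of B ?y]
    by (simp add: q_def)
  finally show ?thesis using q by (simp add: field_simps)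
qed

text \<open>
  The lower bound requires \<open>T'\<close> and \<open>S'\<close> to be close to \<open>T\<close> and \<open>S\<close>. For the distance condition,
  where the opposite closeness is used, write \<open>y = A (B y) + (y - A (B y))\<close> with \<open>B y\<close> in \<open>T\<close>
  and the rest in \<open>S\<close>, and move both vectors to the new subspaces.
\<close>

lemma outer_inverse_exists_near:
  fixes A :: "'a::complex_banach \<Rightarrow>\<^sub>L 'b::complex_banach" and B :: "'b \<Rightarrow>\<^sub>L 'a"
  assumes A: "clinear_op A" and B: "is_outer_inverse A T S B"
    and T: "closed_csubspace T" and S: "closed_csubspace S"
    and T': "closed_csubspace T'" and S': "closed_csubspace S'"
    and \<tau>: "\<And>t. t \<in> T \<Longrightarrow> infdist t T' \<le> \<tau> * norm t" "\<And>t. t \<in> T' \<Longrightarrow> infdist t T \<le> \<tau> * norm t"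
    and \<sigma>: "\<And>s. s \<in> S \<Longrightarrow> infdist s S' \<le> \<sigma> * norm s" "\<And>s. s \<in> S' \<Longrightarrow> infdist s S \<le> \<sigma> * norm s"
    and nonneg: "0 \<le> \<tau>" "0 \<le> \<sigma>"
  defines "\<kappa> \<equiv> norm A * norm B"
  assumes inj: "(1 + \<kappa>) * \<tau> + \<kappa> * \<sigma> < 1" and surj: "\<kappa> * \<tau> + (1 + \<kappa>) * \<sigma> < 1"
  obtains B' where "is_outer_inverse A T' S' B'"
    "norm B' \<le> (1 + \<sigma>) * norm B / (1 - ((1 + \<kappa>) * \<tau> + \<kappa> * \<sigma>))"
proof -
  define c where "c = (1 + \<sigma>) * norm B / (1 - ((1 + \<kappa>) * \<tau> + \<kappa> * \<sigma>))"
  have c: "0 \<le> c" using nonneg inj by (simp add: c_def)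
  obtain B' where B': "is_outer_inverse A T' S' B'" "\<And>y. norm (B' y) \<le> c * norm y"
  proof (rule outer_inverse_exists_of_bounded_below[OF A T' S' _ surj])
    show "norm t \<le> c * norm (A t + s)" if "t \<in> T'" "s \<in> S'" for t s
      using outer_inverse_lower_bound[OF B T S \<tau>(2)[OF that(1)] \<sigma>(2)[OF that(2)] nonneg(2), of 0] inj
      by (simp add: c_def \<kappa>_def)
    show "infdist y {A t + s |t s. t \<in> T' \<and> s \<in> S'} \<le> (\<kappa> * \<tau> + (1 + \<kappa>) * \<sigma>) * norm y" for y
    proof -
      have "B y \<in> T" using B by (auto simp: is_outer_inverse_def op_range_def)
      then have "infdist (B y) T' \<le> \<tau> * norm (B y)" by (rule \<tau>)
      also have "\<dots> \<le> \<tau> * (norm B * norm y)"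
        using nonneg by (intro mult_left_mono norm_blinfun)
      finally have 1: "norm A * infdist (B y) T' \<le> norm A * (\<tau> * (norm B * norm y))"
        by (intro mult_left_mono) auto
      have "B (A (B y)) = B y"
        using B outer_inverse_left_unit[OF B, of B y] by (simp add: is_outer_inverse_def)
      then have "y - A (B y) \<in> S"
        using B by (auto simp: is_outer_inverse_def op_kernel_def blinfun_linear)
      then have "infdist (y - A (B y)) S' \<le> \<sigma> * norm (y - A (B y))" by (rule \<sigma>)
      also have "norm (y - A (B y)) \<le> norm y + norm A * (norm B * norm y)"
        using norm_triangle_ineq4[of y "A (B y)"] norm_blinfun[of A "B y"]
          mult_left_mono[OF norm_blinfun[of B y], of "norm A"] by simp
      finally have 2: "infdist (y - A (B y)) S' \<le> \<sigma> * (norm y + norm A * (norm B * norm y))"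
        using nonneg by (simp add: mult_left_mono)
      have "infdist (A (B y) + (y - A (B y))) {A t + s |t s. t \<in> T' \<and> s \<in> S'}
          \<le> norm A * infdist (B y) T' + infdist (y - A (B y)) S'"
        using closed_csubspaceD(3)[OF T'] closed_csubspaceD(3)[OF S'] by (intro infdist_sum_le) auto
      with 1 2 show ?thesis by (simp add: \<kappa>_def algebra_simps)
    qed
  qed blast
  moreover have "norm B' \<le> c"
    by (rule norm_blinfun_bound[OF c B'(2)])
  ultimately show thesis using that by (simp add: c_def)
qed

text \<open>
  The three smallness conditions are matched: at their limits the first sum equals
  \<open>1 / (1 + \<kappa>) + \<kappa> / (3 + \<kappa>) + 2 * \<kappa> / ((1 + \<kappa>) * (3 + \<kappa>)) = 1\<close>, which
  makes the denominators of the norm estimates positive. The second sum serves the existence for the unperturbed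
  operator.
\<close>

lemma perturbation_parameters:
  fixes \<kappa> \<tau> \<sigma> \<epsilon> :: real
  assumes \<kappa>: "0 < \<kappa>" and \<tau>: "\<tau> < 1 / (1 + \<kappa>)\<^sup>2" and \<sigma>: "0 \<le> \<sigma>" "\<sigma> < 1 / (3 + \<kappa>)"
    and \<epsilon>: "0 \<le> \<epsilon>" "\<epsilon> < 2 * \<kappa> / ((1 + \<kappa>) * (4 + \<kappa>))"
  shows "(1 + \<kappa>) * \<tau> + \<kappa> * \<sigma> + (1 + \<sigma>) * \<epsilon> < 1" and "\<kappa> * \<tau> + (1 + \<kappa>) * \<sigma> < 1"
proof -
  have "(1 + \<kappa>) * \<tau> < (1 + \<kappa>) * (1 / (1 + \<kappa>)\<^sup>2)"
    using \<kappa> \<tau> by (intro mult_strict_left_mono) auto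
  also have "\<dots> = 1 / (1 + \<kappa>)" using \<kappa> by (simp add: power2_eq_square)
  finally have 1: "(1 + \<kappa>) * \<tau> < 1 / (1 + \<kappa>)" .
  have 2: "\<kappa> * \<sigma> < \<kappa> * (1 / (3 + \<kappa>))"
    using \<kappa> \<sigma> by (intro mult_strict_left_mono) auto
  have "(1 + \<sigma>) * \<epsilon> \<le> (1 + 1 / (3 + \<kappa>)) * (2 * \<kappa> / ((1 + \<kappa>) * (4 + \<kappa>)))"
    using \<sigma> \<epsilon> \<kappa> by (intro mult_mono) auto
  also have "1 + 1 / (3 + \<kappa>) = (4 + \<kappa>) / (3 + \<kappa>)" using \<kappa> by (simp add: field_simps)
  also have "\<dots> * (2 * \<kappa> / ((1 + \<kappa>) * (4 + \<kappa>))) = 2 * \<kappa> / ((1 + \<kappa>) * (3 + \<kappa>))"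
    using \<kappa> by (simp add: divide_simps)
  finally have 3: "(1 + \<sigma>) * \<epsilon> \<le> 2 * \<kappa> / ((1 + \<kappa>) * (3 + \<kappa>))" .
  have "1 / (1 + \<kappa>) + \<kappa> * (1 / (3 + \<kappa>)) + 2 * \<kappa> / ((1 + \<kappa>) * (3 + \<kappa>)) = 1"
    using \<kappa> by (simp add: divide_simps) (simp add: algebra_simps)
  with 1 2 3 show "(1 + \<kappa>) * \<tau> + \<kappa> * \<sigma> + (1 + \<sigma>) * \<epsilon> < 1" by linarith
  have "\<kappa> * \<tau> < \<kappa> * (1 / (1 + \<kappa>)\<^sup>2)"
    using \<kappa> \<tau> by (intro mult_strict_left_mono) auto
  moreover have "(1 + \<kappa>) * \<sigma> < (1 + \<kappa>) * (1 / (3 + \<kappa>))"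
    using \<kappa> \<sigma> by (intro mult_strict_left_mono) auto
  moreover have "\<kappa> * (1 / (1 + \<kappa>)\<^sup>2) \<le> 2 / (3 + \<kappa>)"
  proof -
    have "\<kappa> * (3 + \<kappa>) \<le> 2 * (1 + \<kappa>)\<^sup>2"
      using \<kappa> by (simp add: power2_eq_square algebra_simps)
    then show ?thesis using \<kappa> by (simp add: divide_simps)
  qed
  moreover have "2 / (3 + \<kappa>) + (1 + \<kappa>) * (1 / (3 + \<kappa>)) = 1"
    using \<kappa> by (simp add: divide_simps) (simp add: algebra_simps)
  ultimately show "\<kappa> * \<tau> + (1 + \<kappa>) * \<sigma> < 1" by linarith
qed

text \<open>
  The decomposition \<open>y = A (B y) + (y - A (B y))\<close> for \<open>A\<close>, with \<open>A\<close> replaced by \<open>A + E\<close>, misses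
  \<open>y\<close> only by \<open>E (B y)\<close>.
\<close>

lemma outer_inverse_exists_of_perturbation:
  fixes A E :: "'a::complex_banach \<Rightarrow>\<^sub>L 'b::complex_banach" and B :: "'b \<Rightarrow>\<^sub>L 'a"
  assumes AE: "clinear_op (A + E)" and B: "is_outer_inverse A T S B"
    and T: "closed_csubspace T" and S: "closed_csubspace S" and small: "norm E * norm B < 1"
    and lower: "\<And>t s. t \<in> T \<Longrightarrow> s \<in> S \<Longrightarrow> norm t \<le> c * norm ((A + E) t + s)"
  obtains C where "is_outer_inverse (A + E) T S C" "\<And>y. norm (C y) \<le> c * norm y"
proof (rule outer_inverse_exists_of_bounded_below[OF AE T S lower small])
  show "infdist y {(A + E) t + s |t s. t \<in> T \<and> s \<in> S} \<le> norm E * norm B * norm y" for y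
  proof -
    have "B y \<in> T" using B by (auto simp: is_outer_inverse_def op_range_def)
    moreover have "B (A (B y)) = B y"
      using B outer_inverse_left_unit[OF B, of B y] by (simp add: is_outer_inverse_def)
    then have "y - A (B y) \<in> S"
      using B by (auto simp: is_outer_inverse_def op_kernel_def blinfun_linear)
    ultimately have "infdist y {(A + E) t + s |t s. t \<in> T \<and> s \<in> S}
        \<le> dist y ((A + E) (B y) + (y - A (B y)))"
      by (intro infdist_le) blast
    also have "\<dots> = norm (E (B y))" by (simp add: dist_norm blinfun_linear)
    also have "\<dots> \<le> norm E * norm B * norm y"
      using norm_blinfun[of E "B y"] mult_left_mono[OF norm_blinfun[of B y], of "norm E"] by simp
    finally show ?thesis .
  qed
qed blast+

section \<open>Perturbation of the operator, the range and the kernel\<close>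

theorem theorem3p5:
  fixes A E :: "'a::complex_banach \<Rightarrow>\<^sub>L 'b::complex_banach"
    and B :: "'b \<Rightarrow>\<^sub>L 'a"
    and T T' :: "'a set" and S S' :: "'b set"
    and \<kappa> :: real
  assumes "clinear_op A" and "clinear_op E"
    and "closed_csubspace T" and "closed_csubspace S"
    and "outer_inverse_exists A T S"
    and B: "B = outer_inverse A T S"
    and kappa: "\<kappa> = norm A * norm B"
    and "closed_csubspace T'" and "closed_csubspace S'"
    and "gap T T' < 1 / (1 + \<kappa>)^2"
    and "gap S S' < 1 / (3 + \<kappa>)"
    and "norm B * norm E < 2 * \<kappa> / ((1 + \<kappa>) * (4 + \<kappa>))"
  shows "outer_inverse_exists (A + E) T' S'
    \<and> (\<forall>G Gt Ht :: 'b \<Rightarrow>\<^sub>L 'a.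
        clinear_op G \<and> clinear_op Gt \<and> clinear_op Ht
        \<and> op_range G = T \<and> op_range Gt = T' \<and> op_range Ht = T'
        \<and> op_kernel G = S \<and> op_kernel Gt = S \<and> op_kernel Ht = S' \<longrightarrow>
        (let F = Gt - G;
             Ft = Ht - Gt;
             AGg = group_inverse (A \<cdot> G);
             AGtg = group_inverse (A \<cdot> Gt);
             J1 = id_blinfun + AGg \<cdot> A \<cdot> F;
             J2 = id_blinfun + AGtg \<cdot> A \<cdot> Ft;
             J3 = id_blinfun + A \<cdot> F \<cdot> AGg;
             K = id_blinfun + B \<cdot> E
               + (id_blinfun - B \<cdot> A) \<cdot> F \<cdot> op_inverse J1 \<cdot> AGg \<cdot> E
               + (B + (id_blinfun - B \<cdot> A) \<cdot> F \<cdot> op_inverse J1 \<cdot> AGg)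
                 \<cdot> op_inverse J2 \<cdot> AGtg \<cdot> A \<cdot> Ft \<cdot> (id_blinfun - A \<cdot> B) \<cdot> op_inverse J3 \<cdot> E
         in group_invertible (A \<cdot> G) \<and> group_invertible (A \<cdot> Gt)
          \<and> op_invertible J1 \<and> op_invertible J2 \<and> op_invertible J3 \<and> op_invertible K
          \<and> outer_inverse (A + E) T' S' =
              op_inverse K
              \<cdot> (B + (id_blinfun - B \<cdot> A) \<cdot> F \<cdot> op_inverse J1 \<cdot> AGg
                 + (B + (id_blinfun - B \<cdot> A) \<cdot> F \<cdot> op_inverse J1 \<cdot> AGg)
                   \<cdot> op_inverse J2 \<cdot> AGtg \<cdot> A \<cdot> Ft \<cdot> (id_blinfun - A \<cdot> B) \<cdot> op_inverse J3)))
    \<and> norm (outer_inverse (A + E) T' S')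
        \<le> (1 + gap S' S) * norm B
          / (1 - (1 + \<kappa>) * gap T T' - \<kappa> * gap S' S - (1 + gap S' S) * norm B * norm E)
    \<and> norm (outer_inverse (A + E) T' S' - B) / norm B
        \<le> ((1 + \<kappa>) * (gap T T' + gap S' S) + (1 + gap S' S) * norm B * norm E)
          / (1 - (1 + \<kappa>) * gap T T' - \<kappa> * gap S' S - (1 + gap S' S) * norm B * norm E)"
proof -
  note A = assms(1) and E = assms(2) and T = assms(3) and S = assms(4)
    and T' = assms(8) and S' = assms(9)
  have Bo: "is_outer_inverse A T S B"
    using assms(5) B by (auto simp: outer_inverse_exists_def outer_inverse_eqI)
  define \<tau> \<sigma> where "\<tau> = gap T T'" and "\<sigma> = gap S' S"
  have nonneg: "0 \<le> \<tau>" "0 \<le> \<sigma>"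
    using T T' S S' by (simp_all add: \<tau>_def \<sigma>_def gap_nonneg)
  have \<tau>: "t \<in> T \<Longrightarrow> infdist t T' \<le> \<tau> * norm t" "t \<in> T' \<Longrightarrow> infdist t T \<le> \<tau> * norm t" for t
    using infdist_le_gap[OF T T'] infdist_le_gap[OF T' T] by (simp_all add: \<tau>_def gap_commute)
  have \<sigma>: "s \<in> S \<Longrightarrow> infdist s S' \<le> \<sigma> * norm s" "s \<in> S' \<Longrightarrow> infdist s S \<le> \<sigma> * norm s" for s
    using infdist_le_gap[OF S S'] infdist_le_gap[OF S' S] by (simp_all add: \<sigma>_def gap_commute)
  have \<epsilon>: "0 \<le> norm B * norm E" by simp
  have "0 < 2 * \<kappa> / ((1 + \<kappa>) * (4 + \<kappa>))" using assms(12) \<epsilon> by linarith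
  then have "\<kappa> \<noteq> 0" by auto
  then have \<kappa>: "\<kappa> > 0" and B0: "norm B > 0" by (auto simp: kappa)
  note small = perturbation_parameters[OF \<kappa> assms(10)[folded \<tau>_def] nonneg(2)
      assms(11)[unfolded gap_commute[of S], folded \<sigma>_def] \<epsilon> assms(12)]
  define q where "q = (1 + \<kappa>) * \<tau> + \<kappa> * \<sigma> + (1 + \<sigma>) * norm B * norm E"
  have q: "q < 1" using small(1) by (simp add: q_def mult.assoc)
  have inj: "(1 + \<kappa>) * \<tau> + \<kappa> * \<sigma> < 1"
    using small(1) nonneg by (smt (verit) mult_nonneg_nonneg norm_ge_zero)
  have inj\<^sub>1: "(1 + \<kappa>) * \<tau> + \<kappa> * 0 < 1" and surj\<^sub>1: "\<kappa> * \<tau> + (1 + \<kappa>) * 0 < 1"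
    using inj small(2) nonneg \<kappa> by (smt (verit) mult_nonneg_nonneg)+
  \<comment> \<open>Only the range moves here, so the distance for the kernel is zero.\<close>
  obtain B\<^sub>1 where B\<^sub>1: "is_outer_inverse A T' S B\<^sub>1"
    by (rule outer_inverse_exists_near[OF A Bo T S T' S \<tau>, of 0, folded kappa])
      (use nonneg inj\<^sub>1 surj\<^sub>1 in auto)
  obtain B\<^sub>2 where B\<^sub>2: "is_outer_inverse A T' S' B\<^sub>2"
    "norm B\<^sub>2 \<le> (1 + \<sigma>) * norm B / (1 - ((1 + \<kappa>) * \<tau> + \<kappa> * \<sigma>))"
    by (rule outer_inverse_exists_near[OF A Bo T S T' S' \<tau> \<sigma> nonneg, folded kappa, OF _ _ _ _ inj small(2)])
  have "norm E * norm B\<^sub>2 < 1"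
  proof -
    have "norm E * norm B\<^sub>2 \<le> norm E * ((1 + \<sigma>) * norm B / (1 - ((1 + \<kappa>) * \<tau> + \<kappa> * \<sigma>)))"
      using B\<^sub>2(2) by (intro mult_left_mono) auto
    also have "\<dots> < 1" using inj q by (simp add: q_def field_simps)
    finally show ?thesis .
  qed
  moreover define c where "c = (1 + \<sigma>) * norm B / (1 - q)"
  moreover have "norm t \<le> c * norm ((A + E) t + s)" if "t \<in> T'" "s \<in> S'" for t s
    using outer_inverse_lower_bound[OF Bo T S \<tau>(2)[OF that(1)] \<sigma>(2)[OF that(2)] nonneg(2), of E] q
    by (simp add: c_def q_def kappa)
  ultimately obtain C where C: "is_outer_inverse (A + E) T' S' C" "\<And>y. norm (C y) \<le> c * norm y"
    using outer_inverse_exists_of_perturbation[OF _ B\<^sub>2(1) T' S'] A E by (metis clinear_op_simps(2))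
  have c: "0 \<le> c" using nonneg q by (simp add: c_def)
  have C_eq: "outer_inverse (A + E) T' S' = C" by (rule outer_inverse_eqI[OF C(1)])
  have D: "1 - (1 + \<kappa>) * gap T T' - \<kappa> * gap S' S - (1 + gap S' S) * norm B * norm E = 1 - q"
    by (simp add: q_def \<tau>_def \<sigma>_def)
  have norm_C: "norm C \<le> c" by (rule norm_blinfun_bound[OF c C(2)])
  \<comment> \<open>The estimate at \<open>t = C y\<close> and \<open>s = y - (A + E) (C y)\<close>, for which \<open>(A + E) t + s = y\<close>.\<close>
  have "norm (C - B) \<le> q * c + \<sigma> * norm B"
  proof (rule norm_blinfun_bound)
    fix y
    have "C y \<in> T'" using C(1) by (auto simp: is_outer_inverse_def op_range_def)
    moreover have "C ((A + E) (C y)) = C y"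
      using outer_inverse_left_unit[OF C(1), of C y] C(1) by (simp add: is_outer_inverse_def)
    then have "y - (A + E) (C y) \<in> S'"
      using C(1) by (auto simp: is_outer_inverse_def op_kernel_def blinfun.diff_right)
    ultimately have "norm (C y - B y) \<le> q * norm (C y) + \<sigma> * norm B * norm y"
      using outer_inverse_perturbation_estimate[OF Bo T S \<tau>(2) \<sigma>(2) nonneg(2),
          of "C y" "y - (A + E) (C y)" E] by (simp add: q_def kappa)
    also have "\<dots> \<le> q * (c * norm y) + \<sigma> * norm B * norm y"
      using C(2)[of y] nonneg \<kappa> by (intro add_right_mono mult_left_mono) (auto simp: q_def)
    finally show "norm ((C - B) y) \<le> (q * c + \<sigma> * norm B) * norm y"
      by (simp add: blinfun_linear algebra_simps)
  qed (use nonneg \<kappa> c in \<open>auto simp: q_def\<close>)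
  also have "q * c + \<sigma> * norm B = (q + \<sigma>) / (1 - q) * norm B"
    using q by (simp add: c_def field_simps)
  also have "q + \<sigma> = (1 + \<kappa>) * (\<tau> + \<sigma>) + (1 + \<sigma>) * norm B * norm E"
    by (simp add: q_def algebra_simps)
  finally have norm_diff: "norm (C - B) / norm B
      \<le> ((1 + \<kappa>) * (\<tau> + \<sigma>) + (1 + \<sigma>) * norm B * norm E) / (1 - q)"
    using B0 by (simp add: pos_divide_le_eq)
  have "outer_inverse_exists (A + E) T' S'"
    using C(1) by (auto simp: outer_inverse_exists_def)
  then show ?thesis
    unfolding C_eq D
    using norm_C norm_diff outer_inverse_representation[OF A E Bo B\<^sub>1 B\<^sub>2(1) C(1)]
    unfolding c_def \<tau>_def \<sigma>_def by blast
qed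

end
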